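(* Let $\alpha>0$, let $F\in\mathcal{V}_{\alpha,+}$ and let $g$ be an auxiliary function for $F$, with $g(t)>0$ for all sufficiently large $t$. Define two positive sequences $a_n>0$ and $a_n'>0$ by $F(a_n)=e^{-1/n}$ and $F(a_n')=\frac{n}{n+1}$, respectively (for all sufficiently large $n$), and define $A_n:=a_n/a_n'\in(0,1]$. Let $\rho$ be the inverse function (defined near $\infty$) of the function $$t\mapsto t\left\{\frac{\alpha e}{g(t)}-(e+1)\right\}^{\frac{1}{\alpha-g(t)}}$$ considered for sufficiently large $t$. Then there exist a constant $C>0$ and $n_0\in\mathbb{N}$ such that for all $n\ge n_0$, $$\sup_{x\in\mathbb{R}}\left|F^{\vee_b n}(a_nx)-\Phi_\alpha^{\rm boolean}(x)\right|\le C\,\max\left\{g(\rho(a_n)),\ n^{-1},\ A_n^{-1}-1\right\}.$$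
   Context: A neighborhood of $\infty$ is a set containing an interval $(x_0,\infty)$. $\Delta_+$ is the set of all distribution functions on $[0,\infty)$ (extended by $0$ to $(-\infty,0)$). For $\alpha>0$ and a distribution function $F$ on $\mathbb{R}$ differentiable on a neighborhood of $\infty$, put $$k_{\alpha,F}(x)=\frac{xF'(x)}{F(x)(1-F(x))}-\alpha .$$ $\mathcal{V}_\alpha$ is the set of all distribution functions $F$ on $\mathbb{R}$ such that (1) $F(x)<1$ for all $x\in(0,\infty)$, $F(0)=0$, and $F$ is $C^1$ on a neighborhood of $\infty$; (2) (von Mises condition) there exists a non-increasing continuous function $g$ such that $g(x)\to0$ as $x\to\infty$ and $|k_{\alpha,F}(x)|\le g(x)$ for all $x$ in a neighborhood of $\infty$. Any such $g$ is called an auxiliary function for $F$. $\mathcal{V}_{\alpha,+}:=\mathcal{V}_\alpha\cap\Delta_+$. Boolean max-convolution: for $x,y\in(0,1]$, $x\vee_b y\in(0,1]$ is defined by $(x\vee_b y)^{-1}-1=(x^{-1}-1)+(y^{-1}-1)$, and $x\vee_b y:=0$ if $x=0$ or $y=0$. For $F,G\in\Delta_+$, $(F\vee_b G)(x):=F(x)\vee_b G(x)$ for $x\ge0$ (and $0$ for $x<0$), and $F^{\vee_b n}$ is the $n$-fold Boolean max-convolution $F\vee_b\cdots\vee_b F$. $\Phi_\alpha^{\rm boolean}(x)=\frac{1}{1+x^{-\alpha}}$ for $x>0$ and $\Phi_\alpha^{\rm boolean}(x)=0$ for $x\le0$ (Boolean extreme value, or Dagum, distribution). *)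

theory Defs
  imports "HOL-Probability.Probability"
begin

definition distribution_function :: "(real \<Rightarrow> real) \<Rightarrow> bool" where
  "distribution_function F \<longleftrightarrow> (\<exists>M. real_distribution M \<and> F = cdf M)"

definition Delta_plus :: "(real \<Rightarrow> real) set" where
  "Delta_plus = {F. distribution_function F \<and> (\<forall>x<0. F x = 0)}"

definition k_fun :: "real \<Rightarrow> (real \<Rightarrow> real) \<Rightarrow> real \<Rightarrow> real" where
  "k_fun \<alpha> F x = x * deriv F x / (F x * (1 - F x)) - \<alpha>"

text \<open>
  An auxiliary function is only required to be defined, non-increasing and continuous near
  infinity, so its values (as a total function) elsewhere are unconstrained.
\<close>

definition auxiliary_function :: "real \<Rightarrow> (real \<Rightarrow> real) \<Rightarrow> (real \<Rightarrow> real) \<Rightarrow> bool" where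
  "auxiliary_function \<alpha> F g \<longleftrightarrow>
     (\<exists>x0. antimono_on {x0<..} g \<and> continuous_on {x0<..} g \<and> (\<forall>x>x0. \<bar>k_fun \<alpha> F x\<bar> \<le> g x)) \<and>
     (g \<longlongrightarrow> 0) at_top"

definition von_Mises_class :: "real \<Rightarrow> (real \<Rightarrow> real) set" where
  "von_Mises_class \<alpha> = {F. distribution_function F \<and>
     (\<forall>x>0. F x < 1) \<and> F 0 = 0 \<and> (\<exists>x0. F C1_differentiable_on {x0<..}) \<and>
     (\<exists>g. auxiliary_function \<alpha> F g)}"

definition von_Mises_class_plus :: "real \<Rightarrow> (real \<Rightarrow> real) set" where
  "von_Mises_class_plus \<alpha> = von_Mises_class \<alpha> \<inter> Delta_plus"

text \<open>
  On \<open>(0,1]\<close> the Boolean max-convolution is the solution \<open>z\<close> of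
  \<open>1/z - 1 = (1/x - 1) + (1/y - 1)\<close>; see the lemma below.
\<close>

definition bmax :: "real \<Rightarrow> real \<Rightarrow> real" where
  "bmax x y = (if x = 0 \<or> y = 0 then 0 else inverse (1 + ((inverse x - 1) + (inverse y - 1))))"

lemma bmax_characterization:
  assumes "x \<in> {0<..1}" "y \<in> {0<..1}"
  shows "z = bmax x y \<longleftrightarrow>
    z \<in> {0<..1} \<and> inverse z - 1 = (inverse x - 1) + (inverse y - 1)"
proof -
  define s where "s = 1 + ((inverse x - 1) + (inverse y - 1))"
  have "inverse x \<ge> 1" "inverse y \<ge> 1"
    using assms by (auto simp: one_le_inverse_iff)
  hence s: "s \<ge> 1" by (simp add: s_def)
  have b: "bmax x y = inverse s"
    using assms by (auto simp: bmax_def s_def)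
  have "inverse s \<in> {0<..1}"
    using s by (auto simp: inverse_le_1_iff)
  thus ?thesis
    unfolding b using s_def by (metis add_diff_cancel_left' diff_add_cancel inverse_inverse_eq add.commute)
qed

definition bmaxconv :: "(real \<Rightarrow> real) \<Rightarrow> (real \<Rightarrow> real) \<Rightarrow> real \<Rightarrow> real" where
  "bmaxconv F G x = (if x < 0 then 0 else bmax (F x) (G x))"

text \<open>The \<open>n\<close>-fold product has \<open>n\<close> factors for \<open>n \<ge> 1\<close>; the value at \<open>n = 0\<close> is junk.\<close>

definition bmaxconv_power :: "(real \<Rightarrow> real) \<Rightarrow> nat \<Rightarrow> real \<Rightarrow> real" where
  "bmaxconv_power F n = (bmaxconv F ^^ (n - 1)) F"

definition Phi_boolean :: "real \<Rightarrow> real \<Rightarrow> real" where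
  "Phi_boolean \<alpha> x = (if x > 0 then 1 / (1 + x powr (- \<alpha>)) else 0)"

text \<open>
  \<open>\<rho>\<close> inverts a restriction of \<open>h\<close> to a bijection between two neighbourhoods of infinity;
  outside of the target neighbourhood \<open>\<rho>\<close> is arbitrary.
\<close>

definition inverse_near_infinity :: "(real \<Rightarrow> real) \<Rightarrow> (real \<Rightarrow> real) \<Rightarrow> bool" where
  "inverse_near_infinity h \<rho> \<longleftrightarrow>
     (\<exists>T S. bij_betw h {T<..} {S<..} \<and> (\<forall>t>T. \<rho> (h t) = t))"

definition rho_generator :: "real \<Rightarrow> (real \<Rightarrow> real) \<Rightarrow> real \<Rightarrow> real" where
  "rho_generator \<alpha> g t = t * (\<alpha> * exp 1 / g t - (exp 1 + 1)) powr (1 / (\<alpha> - g t))"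

end

theory Submission
  imports Defs
begin

text \<open>
  Write \<open>u = 1/F - 1\<close> and \<open>F\<^sup>n\<close> for the Boolean power. Boolean max-convolution adds these odds, so
  \<open>F\<^sup>n(a\<^sub>n x) = 1 / (1 + n u(a\<^sub>n x))\<close> and \<open>n u(a\<^sub>n) = n (exp (1/n) - 1) = 1 + O(1/n)\<close>. Moreover
  \<open>k\<close> is, up to sign, the derivative of \<open>ln u + \<alpha> ln\<close> with respect to \<open>ln x\<close>. With
  \<open>t = a\<^sub>n\<close> and \<open>s = \<rho>(t)\<close> this gives
  \<open>\<bar>ln (u(t x) / u(t)) + \<alpha> ln x\<bar> \<le> g(s) \<bar>ln x\<bar>\<close> whenever \<open>t x \<ge> s\<close>, and the logistic function turns
  such a relative error of its argument into an absolute error \<open>O(g(s))\<close>. For \<open>t x < s\<close> both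
  distribution functions are at most their values at \<open>s/t\<close>, and \<open>\<rho>\<close> is chosen such that
  these are \<open>O(g(s))\<close> as well.
\<close>

section \<open>Perturbation of the logistic function and of the log-odds\<close>

text \<open>Mean value theorem on the segment from \<open>q\<close> to \<open>p\<close>: the slope
  at \<open>z\<close> is at most \<open>1 / (1 + \<bar>z\<bar>)\<close>, and
  \<open>d \<le> 1/2\<close> keeps the whole segment at distance at least
  \<open>\<bar>q\<bar> / 2\<close> from 0. The decay of the slope absorbs the factor
  \<open>\<bar>q\<bar>\<close>, so the bound is uniform in \<open>q\<close>.\<close>

lemma logistic_relative_perturbation:
  fixes p q d :: real
  assumes "\<bar>p - q\<bar> \<le> d * \<bar>q\<bar>" and "0 \<le> d" "d \<le> 1/2"
  shows "\<bar>1 / (1 + exp p) - 1 / (1 + exp q)\<bar> \<le> 2 * d"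
proof -
  define B where "B = 1 / (1 + \<bar>q\<bar> / 2)"
  define S where "S = closed_segment p q"
  have far: "\<bar>z\<bar> \<ge> \<bar>q\<bar> / 2" if "z \<in> S" for z
  proof -
    have "\<bar>z - q\<bar> \<le> \<bar>p - q\<bar>"
      using that unfolding S_def closed_segment_eq_real_ivl by (auto split: if_splits)
    moreover have "d * \<bar>q\<bar> \<le> 1/2 * \<bar>q\<bar>"
      using assms by (intro mult_right_mono) auto
    ultimately show ?thesis using assms(1) by linarith
  qed
  have der: "((\<lambda>z. 1 / (1 + exp z)) has_field_derivative - exp z / (1 + exp z)^2) (at z within S)" for z :: real
  proof -
    have "1 + exp z \<noteq> 0" using exp_gt_zero[of z] by linarith
    then show ?thesis
      by (auto intro!: derivative_eq_intros simp: power2_eq_square)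
  qed
  have bnd: "norm (- exp z / (1 + exp z)^2) \<le> B" if "z \<in> S" for z
  proof -
    have pos: "exp z > 0" by simp
    have "exp z / (1 + exp z)^2 = 1 / (exp z + 2 + exp (-z))"
      using pos by (simp add: exp_minus field_simps power2_eq_square)
    also have "\<dots> \<le> B"
      unfolding B_def
    proof (rule divide_left_mono)
      have "1 + \<bar>z\<bar> \<le> exp \<bar>z\<bar>" by (rule exp_ge_add_one_self)
      also have "\<dots> \<le> exp z + exp (-z)" by (cases "z \<ge> 0") auto
      finally show "1 + \<bar>q\<bar>/2 \<le> exp z + 2 + exp (-z)" using far[OF that] by linarith
    qed (auto intro!: mult_pos_pos add_pos_pos add_pos_nonneg)
    finally show ?thesis by simp
  qed
  have "norm (1 / (1 + exp p) - 1 / (1 + exp q)) \<le> B * norm (p - q)"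
    by (rule field_differentiable_bound[of S]) (use der bnd in \<open>auto simp: S_def\<close>)
  also have "\<dots> \<le> B * (d * \<bar>q\<bar>)"
    using assms(1) by (intro mult_left_mono) (auto simp: B_def)
  also have "\<dots> \<le> 2 * d"
    unfolding B_def using assms(2) by (simp add: field_simps)
  finally show ?thesis by simp
qed

lemma ln_odds_increment:
  fixes F g :: "real \<Rightarrow> real"
  assumes "s > 0"
    and diff: "\<And>y. y \<ge> s \<Longrightarrow> F differentiable (at y)"
    and pos: "\<And>y. y \<ge> s \<Longrightarrow> 0 < F y" and less1: "\<And>y. y \<ge> s \<Longrightarrow> F y < 1"
    and k: "\<And>y. y \<ge> s \<Longrightarrow> \<bar>k_fun \<alpha> F y\<bar> \<le> K"
    and "x \<ge> s" "y \<ge> s"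
  shows "\<bar>ln (1 / F x - 1) - ln (1 / F y - 1) + \<alpha> * (ln x - ln y)\<bar> \<le> K * \<bar>ln x - ln y\<bar>"
proof -
  \<comment> \<open>In the logarithmic variable the derivative is exactly \<open>- k_fun\<close>, so
    a bound on \<open>k_fun\<close> is a Lipschitz constant of \<open>L\<close>.\<close>
  define L where "L = (\<lambda>z. ln (1 / F (exp z) - 1) + \<alpha> * z)"
  define S where "S = {ln s..}"
  have der: "(L has_field_derivative - k_fun \<alpha> F (exp z)) (at z within S)" if "z \<in> S" for z
  proof -
    have ge: "exp z \<ge> s"
      using that \<open>s > 0\<close> unfolding S_def by (metis atLeast_iff exp_le_cancel_iff exp_ln)
    note Fz = pos[OF ge] less1[OF ge]
    have "(F has_field_derivative deriv F (exp z)) (at (exp z))"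
      using diff[OF ge] by (metis DERIV_imp_deriv real_differentiable_def)
    then have dF: "((\<lambda>z. F (exp z)) has_field_derivative deriv F (exp z) * exp z) (at z within S)"
      by (intro DERIV_chain2[where f = F and g = exp] has_field_derivative_at_within[OF DERIV_exp])
    have "(L has_field_derivative
        (- (deriv F (exp z) * exp z) / (F (exp z))^2) / (1 / F (exp z) - 1) + \<alpha>) (at z within S)"
      unfolding L_def using Fz
      by (auto intro!: derivative_eq_intros dF simp: power2_eq_square field_simps)
    also have "(- (deriv F (exp z) * exp z) / (F (exp z))^2) / (1 / F (exp z) - 1) + \<alpha> = - k_fun \<alpha> F (exp z)"
      using Fz by (simp add: k_fun_def field_simps power2_eq_square)
    finally show ?thesis .
  qed
  have "norm (L (ln x) - L (ln y)) \<le> K * norm (ln x - ln y)"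
  proof (rule field_differentiable_bound[OF _ der])
    show "norm (- k_fun \<alpha> F (exp z)) \<le> K" if "z \<in> S" for z
      using that k[of "exp z"] \<open>s > 0\<close> unfolding S_def
      by (simp, metis exp_le_cancel_iff exp_ln)
  qed (use assms in \<open>auto simp: S_def\<close>)
  then show ?thesis
    using assms by (simp add: L_def algebra_simps)
qed

section \<open>Boolean powers and the Dagum distribution\<close>

lemma bmaxconv_power_eq:
  fixes F :: "real \<Rightarrow> real"
  assumes "\<And>x. 0 \<le> F x" "\<And>x. F x \<le> 1" "\<And>x. x < 0 \<Longrightarrow> F x = 0" "n \<ge> 1"
  shows "bmaxconv_power F n x = (if F x = 0 then 0 else 1 / (1 + real n * (1 / F x - 1)))"
proof -
  \<comment> \<open>The iteration starts from \<open>F\<close> itself, so \<open>m\<close>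
    convolutions yield \<open>Suc m\<close> factors. Negative \<open>x\<close> fall under
    \<open>F x = 0\<close>.\<close>
  have "(bmaxconv F ^^ m) F x = (if F x = 0 then 0 else 1 / (1 + real (Suc m) * (1 / F x - 1)))" for m
  proof (induction m)
    case (Suc m)
    show ?case
    proof (cases "F x = 0")
      case False
      then have F: "0 < F x" "F x \<le> 1" "x \<ge> 0"
        using assms(1-3)[of x] by (auto simp: less_le intro: leI)
      define u where "u = 1 / F x - 1"
      have "u \<ge> 0" using F by (simp add: u_def)
      then have "1 + real (Suc m) * u > 0" by (intro add_pos_nonneg) auto
      moreover have "inverse (F x) - 1 = u" by (simp add: u_def field_simps)
      moreover have "(bmaxconv F ^^ m) F x = inverse (1 + real (Suc m) * u)"
        using Suc False by (simp add: u_def inverse_eq_divide)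
      ultimately have "(bmaxconv F ^^ Suc m) F x = inverse (1 + (u + (1 + real (Suc m) * u - 1)))"
        using F False by (simp add: bmaxconv_def[of F "(bmaxconv F ^^ m) F"] bmax_def)
      then show ?thesis
        using False unfolding u_def[symmetric] by (simp add: inverse_eq_divide algebra_simps)
    qed (auto simp: bmaxconv_def bmax_def)
  qed simp
  from this[of "n - 1"] \<open>n \<ge> 1\<close> show ?thesis
    by (simp add: bmaxconv_power_def)
qed

text \<open>Serves for arguments below \<open>s\<close>, where \<open>k_fun\<close> is not
  controlled and only comparison with the value at \<open>s\<close> remains.\<close>

lemma bmaxconv_power_mono:
  fixes F :: "real \<Rightarrow> real"
  assumes "\<And>x. 0 \<le> F x" "\<And>x. F x \<le> 1" "\<And>x. x < 0 \<Longrightarrow> F x = 0" "n \<ge> 1"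
    and "F x \<le> F y"
  shows "0 \<le> bmaxconv_power F n x" "bmaxconv_power F n x \<le> bmaxconv_power F n y"
proof -
  have nn: "1 + real n * (1 / F z - 1) \<ge> 1" if "F z \<noteq> 0" for z
    using assms(1,2)[of z] that by (auto simp: le_divide_eq)
  show "0 \<le> bmaxconv_power F n x"
    using nn[of x] by (auto simp: bmaxconv_power_eq[OF assms(1-4)])
  show "bmaxconv_power F n x \<le> bmaxconv_power F n y"
  proof (cases "F x = 0")
    case True
    then show ?thesis using nn[of y] by (auto simp: bmaxconv_power_eq[OF assms(1-4)])
  next
    case False
    then have F: "0 < F x" "0 < F y" using assms(1)[of x] assms(5) by auto
    then have "1 / F y \<le> 1 / F x" using assms(5) by (simp add: frac_le)
    then have "1 + real n * (1 / F y - 1) \<le> 1 + real n * (1 / F x - 1)"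
      by (simp add: mult_left_mono)
    then show ?thesis
      using F nn[of y] by (auto simp: bmaxconv_power_eq[OF assms(1-4)] intro!: frac_le)
  qed
qed

lemma Phi_boolean_exp:
  assumes "x > 0"
  shows "Phi_boolean \<alpha> x = 1 / (1 + exp (- \<alpha> * ln x))"
  using assms by (simp add: Phi_boolean_def powr_def)

lemma Phi_boolean_mono:
  assumes "\<alpha> > 0" "0 < x" "x \<le> y"
  shows "Phi_boolean \<alpha> x \<le> Phi_boolean \<alpha> y"
proof -
  have "y powr (-\<alpha>) \<le> x powr (-\<alpha>)" using assms by (intro powr_mono2') auto
  then show ?thesis
    using assms by (auto simp: Phi_boolean_def intro!: frac_le add_pos_nonneg)
qed

text \<open>The difference is \<open>c - 1\<close> times a fraction in [0,1], hence small uniformly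
  in \<open>v\<close>. With \<open>c\<close> equal to \<open>n\<close> times the odds at the
  quantile, this is the source of the term \<open>1 / n\<close>.\<close>

lemma inverse_one_plus_scale_le:
  fixes v c :: real
  assumes "v \<ge> 0" "c \<ge> 1"
  shows "\<bar>1 / (1 + c * v) - 1 / (1 + v)\<bar> \<le> c - 1"
proof -
  have cv: "c * v \<ge> 0" using assms by simp
  have "1 + v \<noteq> 0" "1 + c * v \<noteq> 0" using assms cv by linarith+
  then have "1 / (1 + v) - 1 / (1 + c * v) = (c - 1) * (v / ((1 + v) * (1 + c * v)))"
    by (simp add: divide_simps) (simp add: algebra_simps)
  moreover define w where "w = v / ((1 + v) * (1 + c * v))"
  ultimately have "1 / (1 + v) - 1 / (1 + c * v) = (c - 1) * w" by simp
  moreover have "0 \<le> w" "w \<le> 1"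
    unfolding w_def using assms cv by (auto simp: divide_le_eq algebra_simps intro: add_pos_nonneg)
  then have "0 \<le> (c - 1) * w" "(c - 1) * w \<le> (c - 1) * 1"
    using assms by (intro mult_nonneg_nonneg mult_left_mono; simp)+
  ultimately show ?thesis by (simp add: abs_minus_commute[of "1 / (1 + c * v)"])
qed

section \<open>The function inverted by \<rho>\<close>

text \<open>The constants enter through \<open>\<alpha> e / g - (e + 1) \<ge> \<alpha> / g \<ge> 4\<close>, valid for \<open>g \<le> \<alpha> / 4\<close>.\<close>

lemma rho_generator_base_ge:
  fixes \<alpha> g :: real
  assumes "0 < g" "g \<le> \<alpha> / 4"
  shows "\<alpha> / g \<le> \<alpha> * exp 1 / g - (exp 1 + 1)" "4 \<le> \<alpha> / g"
proof -
  show 4: "4 \<le> \<alpha> / g" using assms by (simp add: field_simps)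
  have e: "exp (1::real) \<ge> 2" using exp_ge_add_one_self[of "1::real"] by simp
  have "4 * (exp 1 - 1) \<le> \<alpha> / g * (exp 1 - 1)"
    using 4 e by (intro mult_right_mono) auto
  then show "\<alpha> / g \<le> \<alpha> * exp 1 / g - (exp 1 + 1)"
    using e by (simp add: algebra_simps)
qed

text \<open>Used twice: as the upper bracket in the intermediate value argument for \<rho>, and to
  place \<open>s = \<rho> t\<close> below \<open>t\<close>.\<close>

lemma rho_generator_ge:
  assumes "0 < g t" "g t \<le> \<alpha> / 4" "t > 0"
  shows "t \<le> rho_generator \<alpha> g t"
proof -
  have "1 \<le> (\<alpha> * exp 1 / g t - (exp 1 + 1)) powr (1 / (\<alpha> - g t))"
    using rho_generator_base_ge[OF assms(1,2)] assms by (intro ge_one_powr_ge_zero) auto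
  then show ?thesis
    using assms(3) mult_left_mono[of 1 _ t] unfolding rho_generator_def by auto
qed

text \<open>With \<open>B\<close> the base of the power and
  \<open>x = s / rho_generator \<alpha> g s\<close>, one has
  \<open>x powr (- \<alpha>) = B powr (\<alpha> / (\<alpha> - g s))\<close>. This is at least
  \<open>B \<ge> \<alpha> / g s\<close>, since the exponent is at least 1 and
  \<open>B \<ge> 1\<close>.\<close>

lemma Phi_boolean_rho_generator_le:
  assumes "0 < g s" "g s \<le> \<alpha> / 4" "s > 0"
  shows "Phi_boolean \<alpha> (s / rho_generator \<alpha> g s) \<le> g s / \<alpha>"
proof -
  define B where "B = \<alpha> * exp 1 / g s - (exp 1 + 1)"
  have B: "\<alpha> / g s \<le> B" "4 \<le> \<alpha> / g s"
    using rho_generator_base_ge[OF assms(1,2)] by (auto simp: B_def)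
  define x where "x = s / rho_generator \<alpha> g s"
  have x: "x = B powr (- (1 / (\<alpha> - g s)))"
    using assms by (simp add: x_def rho_generator_def B_def powr_minus field_simps)
  have xpos: "x > 0" using B by (simp add: x)
  have "\<alpha> / g s \<le> B powr 1" using B by simp
  also have "B powr 1 \<le> B powr (\<alpha> / (\<alpha> - g s))"
    using B assms by (intro powr_mono) auto
  also have "\<dots> = x powr (- \<alpha>)"
    by (simp add: x powr_powr)
  finally have "\<alpha> / g s \<le> 1 + x powr (- \<alpha>)" by simp
  then have "1 / (1 + x powr (- \<alpha>)) \<le> 1 / (\<alpha> / g s)"
    using B by (intro frac_le) auto
  then show ?thesis
    unfolding x_def[symmetric] using xpos by (simp add: Phi_boolean_def)
qed

text \<open>The hypothesis fixes \<rho> only on images of points beyond some \<open>T\<close>.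
  Continuity shows that every large \<open>t\<close> is the image of a point that is beyond
  \<open>T\<close> and at least \<open>t0\<close>.\<close>

lemma inverse_near_infinity_rho_generator:
  assumes inv: "inverse_near_infinity (rho_generator \<alpha> g) \<rho>"
    and cont: "continuous_on {t0..} g" and "t0 > 0"
    and g: "\<And>t. t \<ge> t0 \<Longrightarrow> 0 < g t \<and> g t \<le> \<alpha> / 4"
  shows "\<forall>\<^sub>F t in at_top. \<rho> t \<ge> t0 \<and> rho_generator \<alpha> g (\<rho> t) = t"
proof -
  define h where "h = rho_generator \<alpha> g"
  from inv obtain T where T: "\<And>t. t > T \<Longrightarrow> \<rho> (h t) = t"
    by (auto simp: inverse_near_infinity_def h_def)
  define t1 where "t1 = max t0 (T + 1)"
  have t1: "t1 \<ge> t0" "t1 > T" "t1 > 0" using \<open>t0 > 0\<close> by (auto simp: t1_def)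
  have conth: "continuous_on {t1..} h"
    unfolding h_def rho_generator_def
  proof (intro continuous_intros)
    show "continuous_on {t1..} g" using cont t1 by (auto intro: continuous_on_subset)
    then show "continuous_on {t1..} g" .
    have "0 < g t \<and> g t < \<alpha>" if "t \<in> {t1..}" for t
      using g[of t] t1 that by auto
    then show "\<forall>t\<in>{t1..}. g t \<noteq> 0" "\<forall>t\<in>{t1..}. \<alpha> - g t \<noteq> 0"
      by fastforce+
    show "\<forall>t\<in>{t1..}. \<alpha> * exp 1 / g t - (exp 1 + 1) \<noteq> 0"
    proof
      fix t assume "t \<in> {t1..}"
      then have "0 < g t" "g t \<le> \<alpha> / 4" using g[of t] t1 by auto
      from rho_generator_base_ge[OF this] show "\<alpha> * exp 1 / g t - (exp 1 + 1) \<noteq> 0" by linarith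
    qed
  qed
  \<comment> \<open>On \<open>{t1..t}\<close> the value \<open>t\<close> is bracketed:
    \<open>h t1 \<le> t \<le> h t\<close>.\<close>
  have "\<rho> t \<ge> t0 \<and> h (\<rho> t) = t" if t: "t \<ge> max t1 (h t1)" for t
  proof -
    have "t \<le> h t"
      unfolding h_def using g[of t] t t1 by (intro rho_generator_ge) auto
    moreover have "continuous_on {t1..t} h"
      using conth by (rule continuous_on_subset) auto
    ultimately obtain s where "t1 \<le> s" "s \<le> t" "h s = t"
      using IVT'[of h t1 t t] t by auto
    then show ?thesis using T[of s] t1 by auto
  qed
  then show ?thesis
    unfolding h_def eventually_at_top_linorder by blast
qed

section \<open>Distribution functions and quantiles\<close>

lemma distribution_functionD:
  assumes "distribution_function F"
  shows "mono F" "0 \<le> F x" "F x \<le> 1" "(F \<longlongrightarrow> 1) at_top"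
proof -
  obtain M where M: "real_distribution M" "F = cdf M"
    using assms by (auto simp: distribution_function_def)
  interpret real_distribution M by fact
  show "mono F" "0 \<le> F x" "F x \<le> 1" "(F \<longlongrightarrow> 1) at_top"
    unfolding M(2) using cdf_nondecreasing cdf_nonneg cdf_bounded_prob cdf_lim_at_top_prob
    by (auto intro: monoI)
qed

text \<open>Since \<open>F K < 1\<close> for each \<open>K > 0\<close>, levels tending to 1
  eventually exceed \<open>F K\<close>, and monotonicity pushes \<open>a n\<close> past
  \<open>K\<close>.\<close>

lemma filterlim_quantile_at_top:
  fixes F :: "real \<Rightarrow> real"
  assumes "mono F" "\<And>x. x > 0 \<Longrightarrow> F x < 1" "(q \<longlongrightarrow> 1) \<F>"
    and "\<forall>\<^sub>F n in \<F>. F (a n) = q n"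
  shows "filterlim a at_top \<F>"
  unfolding filterlim_at_top_gt[where c = 0]
proof (intro allI impI)
  fix K :: real assume "K > 0"
  then have "F K < 1" by (rule assms)
  with assms(3) have "\<forall>\<^sub>F n in \<F>. F K < q n" by (rule order_tendstoD)
  with assms(4) show "\<forall>\<^sub>F n in \<F>. K \<le> a n"
    by eventually_elim (metis assms(1) leI less_imp_le monoD not_le)
qed

section \<open>The estimate where the von Mises condition is available\<close>

text \<open>Two replacements: \<open>c\<close> by 1 costs \<open>1 / n\<close>, and the odds ratio
  \<open>v\<close> by \<open>x powr (- \<alpha>)\<close> costs
  \<open>2 * (K / \<alpha>)\<close>.\<close>

lemma bmaxconv_power_quantile_approx:
  fixes F g :: "real \<Rightarrow> real"
  assumes "\<alpha> > 0"
    and F01: "\<And>x. 0 \<le> F x" "\<And>x. F x \<le> 1" and neg: "\<And>x. x < 0 \<Longrightarrow> F x = 0"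
    and "n \<ge> 1" and t: "F t = exp (- 1 / real n)" "s \<le> t" "s > 0"
    and diff: "\<And>y. y \<ge> s \<Longrightarrow> F differentiable (at y)"
    and pos: "\<And>y. y \<ge> s \<Longrightarrow> 0 < F y" and less1: "\<And>y. y \<ge> s \<Longrightarrow> F y < 1"
    and k: "\<And>y. y \<ge> s \<Longrightarrow> \<bar>k_fun \<alpha> F y\<bar> \<le> K" and K: "K \<le> \<alpha> / 2"
    and x: "s \<le> t * x"
  shows "\<bar>bmaxconv_power F n (t * x) - Phi_boolean \<alpha> x\<bar> \<le> 1 / real n + 2 * (K / \<alpha>)"
proof -
  define u where "u = (\<lambda>x. 1 / F x - 1)"
  have upos: "u y > 0" if "y \<ge> s" for y
    using pos[OF that] less1[OF that] by (simp add: u_def)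
  have tpos: "t > 0" using t by simp
  have xpos: "x > 0" using x t(3) tpos by (metis less_le_trans zero_less_mult_pos)
  have K0: "K \<ge> 0" using k[of s] by auto
  define c where "c = real n * u t"
  \<comment> \<open>The odds at level \<open>exp (- 1 / n)\<close> are
    \<open>exp (1 / n) - 1\<close>; second-order bounds on \<open>exp\<close> then place
    \<open>c\<close> in \<open>[1, 1 + 1 / n]\<close>.\<close>
  have c: "c = real n * (exp (1 / real n) - 1)"
    by (simp add: c_def u_def t(1) exp_minus field_simps)
  have c1: "c \<ge> 1"
    using exp_ge_add_one_self[of "1 / real n"] \<open>n \<ge> 1\<close> unfolding c by (simp add: field_simps)
  have c2: "c - 1 \<le> 1 / real n"
    using exp_bound[of "1 / real n"] \<open>n \<ge> 1\<close> unfolding c by (simp add: field_simps power2_eq_square)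
  define v where "v = u (t * x) / u t"
  have vpos: "v > 0" using upos[of t] upos[of "t*x"] x t by (simp add: v_def)
  have "bmaxconv_power F n (t * x) = 1 / (1 + c * v)"
    using pos[of "t * x"] x upos[of t] t
    by (simp add: bmaxconv_power_eq[OF F01 neg \<open>n \<ge> 1\<close>] c_def v_def u_def)
  then have 1: "\<bar>bmaxconv_power F n (t * x) - 1 / (1 + v)\<bar> \<le> 1 / real n"
    using inverse_one_plus_scale_le[of v c] vpos c1 c2 by simp
  have "\<bar>ln (u (t * x)) - ln (u t) + \<alpha> * (ln (t * x) - ln t)\<bar> \<le> K * \<bar>ln (t * x) - ln t\<bar>"
    unfolding u_def
    by (rule ln_odds_increment[OF t(3) diff pos less1 k]) (use x t in auto)
  then have "\<bar>ln v + \<alpha> * ln x\<bar> \<le> K * \<bar>ln x\<bar>"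
    using upos[of t] upos[of "t*x"] x t xpos tpos by (simp add: v_def ln_div ln_mult)
  \<comment> \<open>Error relative to \<open>q = - \<alpha> * ln x\<close>, the logistic argument of
    \<open>Phi_boolean\<close>; \<open>K \<le> \<alpha> / 2\<close> makes
    \<open>d = K / \<alpha>\<close> admissible.\<close>
  then have "\<bar>ln v - (- \<alpha> * ln x)\<bar> \<le> K / \<alpha> * \<bar>- \<alpha> * ln x\<bar>"
    using \<open>\<alpha> > 0\<close> by (simp add: abs_mult)
  from logistic_relative_perturbation[OF this]
  have "\<bar>1 / (1 + v) - Phi_boolean \<alpha> x\<bar> \<le> 2 * (K / \<alpha>)"
    using K K0 \<open>\<alpha> > 0\<close> vpos xpos by (simp add: Phi_boolean_exp field_simps)
  with 1 show ?thesis by linarith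
qed

section \<open>The uniform rate of convergence\<close>

theorem theorem1p2:
  fixes \<alpha> :: real and F g \<rho> :: "real \<Rightarrow> real" and a a' A :: "nat \<Rightarrow> real"
  assumes "\<alpha> > 0"
    and "F \<in> von_Mises_class_plus \<alpha>"
    and "auxiliary_function \<alpha> F g"
    and "\<forall>\<^sub>F t in at_top. g t > 0"
    and "\<forall>\<^sub>F n in sequentially. a n > 0 \<and> F (a n) = exp (- 1 / real n)"
    and "\<forall>\<^sub>F n in sequentially. a' n > 0 \<and> F (a' n) = real n / (real n + 1)"
    and "\<And>n. A n = a n / a' n"
    and "inverse_near_infinity (rho_generator \<alpha> g) \<rho>"
  shows "\<exists>C>0. \<exists>n0. \<forall>n\<ge>n0.
    (SUP x. \<bar>bmaxconv_power F n (a n * x) - Phi_boolean \<alpha> x\<bar>)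
      \<le> C * Max {g (\<rho> (a n)), 1 / real n, inverse (A n) - 1}"
proof -
  from assms(2) have df: "distribution_function F" and less1: "\<And>x. x > 0 \<Longrightarrow> F x < 1"
    and F0: "F 0 = 0" and neg: "\<And>x. x < 0 \<Longrightarrow> F x = 0"
    and "\<exists>x0. F C1_differentiable_on {x0<..}"
    by (auto simp: von_Mises_class_plus_def von_Mises_class_def Delta_plus_def)
  then obtain x1 where x1: "F C1_differentiable_on {x1<..}" by blast
  note F = distribution_functionD[OF df]
  from assms(3) obtain x2 where x2: "antimono_on {x2<..} g" "continuous_on {x2<..} g"
    "\<And>x. x > x2 \<Longrightarrow> \<bar>k_fun \<alpha> F x\<bar> \<le> g x" and g0: "(g \<longlongrightarrow> 0) at_top"
    by (auto simp: auxiliary_function_def)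
  \<comment> \<open>The threshold serves both the bounds on \<open>rho_generator\<close> and the
    requirement \<open>K \<le> \<alpha> / 2\<close> with \<open>K = g s\<close>.\<close>
  have "\<forall>\<^sub>F t in at_top. g t < \<alpha> / 4"
    using order_tendstoD(2)[OF g0, of "\<alpha> / 4"] \<open>\<alpha> > 0\<close> by simp
  moreover have "\<forall>\<^sub>F t in at_top. F t > 0"
    using order_tendstoD(1)[OF F(4), of 0] by simp
  ultimately have "\<forall>\<^sub>F t in at_top. 0 < g t \<and> g t < \<alpha> / 4 \<and> 0 < F t \<and> x1 < t \<and> x2 < t \<and> 0 < t"
    using assms(4) eventually_gt_at_top[of x1] eventually_gt_at_top[of x2] eventually_gt_at_top[of 0]
    by eventually_elim auto
  then obtain t0 where t0: "\<And>t. t \<ge> t0 \<Longrightarrow> 0 < g t \<and> g t < \<alpha> / 4 \<and> 0 < F t \<and> x1 < t \<and> x2 < t \<and> 0 < t"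
    by (auto simp: eventually_at_top_linorder)
  have "filterlim a at_top sequentially"
  proof (rule filterlim_quantile_at_top[OF F(1) less1])
    have "(\<lambda>n. exp (- 1 / real n)) \<longlonglongrightarrow> exp 0"
      by (intro tendsto_exp real_tendsto_divide_at_top[OF tendsto_const] filterlim_real_sequentially)
    then show "(\<lambda>n. exp (- 1 / real n)) \<longlonglongrightarrow> 1" by simp
    show "\<forall>\<^sub>F n in sequentially. F (a n) = exp (- 1 / real n)"
      using assms(5) by eventually_elim simp
  qed auto
  moreover have "\<forall>\<^sub>F t in at_top. \<rho> t \<ge> t0 \<and> rho_generator \<alpha> g (\<rho> t) = t"
    by (rule inverse_near_infinity_rho_generator[OF assms(8)])
      (use t0 x2(2) in \<open>fastforce intro: continuous_on_subset less_imp_le\<close>)+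
  ultimately have "\<forall>\<^sub>F n in sequentially. \<rho> (a n) \<ge> t0 \<and> rho_generator \<alpha> g (\<rho> (a n)) = a n"
    by (rule filterlim_iff[THEN iffD1, rule_format])
  with assms(5) eventually_ge_at_top[of 1]
  have "\<forall>\<^sub>F n in sequentially. n \<ge> 1 \<and> F (a n) = exp (- 1 / real n) \<and> \<rho> (a n) \<ge> t0 \<and>
      rho_generator \<alpha> g (\<rho> (a n)) = a n"
    by eventually_elim auto
  then obtain n0 where n0: "\<And>n. n \<ge> n0 \<Longrightarrow> n \<ge> 1 \<and> F (a n) = exp (- 1 / real n) \<and> \<rho> (a n) \<ge> t0 \<and>
      rho_generator \<alpha> g (\<rho> (a n)) = a n"
    by (auto simp: eventually_at_top_linorder)
  \<comment> \<open>The pointwise error is at most \<open>1 / n + 3 * (g s / \<alpha>)\<close>, and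
    both \<open>1 / n\<close> and \<open>g s\<close> are bounded by the maximum.\<close>
  define C where "C = 1 + 3 / \<alpha>"
  have "(SUP x. \<bar>bmaxconv_power F n (a n * x) - Phi_boolean \<alpha> x\<bar>)
      \<le> C * Max {g (\<rho> (a n)), 1 / real n, inverse (A n) - 1}" if "n \<ge> n0" for n
  proof (rule cSUP_least)
    fix x :: real
    define t s where "t = a n" and "s = \<rho> t"
    have n1: "n \<ge> 1" and Ft: "F t = exp (- 1 / real n)" and s: "s \<ge> t0"
      and hs: "rho_generator \<alpha> g s = t"
      using n0[OF that] by (auto simp: t_def s_def)
    have gs: "0 < g s" "g s \<le> \<alpha> / 4" "s > 0" "s > x2" using t0[OF s] by auto
    have st: "s \<le> t" using rho_generator_ge[of g s \<alpha>, OF gs(1-3)] hs by simp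
    have t: "t > 0" using st gs by simp
    let ?P = "bmaxconv_power F n" and ?E = "1 / real n + 2 * (g s / \<alpha>)"
    have near: "\<bar>?P (t * y) - Phi_boolean \<alpha> y\<bar> \<le> ?E" if "s \<le> t * y" for y
    proof (rule bmaxconv_power_quantile_approx[where F = F, OF \<open>\<alpha> > 0\<close> F(2,3) neg n1 Ft st gs(3)])
      fix z assume "s \<le> z"
      then have z: "z \<ge> t0" using s by simp
      show "F differentiable (at z)"
        using x1 t0[OF z] by (auto simp: C1_differentiable_on_eq)
      show "0 < F z" "F z < 1" using t0[OF z] less1 by auto
      \<comment> \<open>As \<open>g\<close> is non-increasing beyond \<open>x2\<close>, the single
        constant \<open>g s\<close> controls \<open>k_fun\<close> on the whole half-line from
        \<open>s\<close>.\<close>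
      have "g z \<le> g s"
        using x2(1) \<open>s \<le> z\<close> gs(4) by (auto simp: monotone_on_def)
      then show "\<bar>k_fun \<alpha> F z\<bar> \<le> g s" using x2(3)[of z] t0[OF z] by auto
    qed (use that gs in auto)
    have "\<bar>?P (t * x) - Phi_boolean \<alpha> x\<bar> \<le> 1 / real n + 3 * (g s / \<alpha>)"
    proof -
      have g\<alpha>: "g s / \<alpha> \<ge> 0" using gs \<open>\<alpha> > 0\<close> by simp
      consider "x \<le> 0" | "x > 0" "s \<le> t * x" | "x > 0" "t * x < s" by linarith
      then show ?thesis
      proof cases
        case 1
        then have "t * x \<le> 0" using t by (simp add: mult_nonneg_nonpos)
        then have "F (t * x) = 0" using F0 neg by (metis less_eq_real_def)
        then show ?thesis
          using 1 g\<alpha> by (simp add: bmaxconv_power_eq[OF F(2,3) neg n1] Phi_boolean_def)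
      next
        case 2
        then show ?thesis using near[of x] g\<alpha> by simp
      next
        case 3
        \<comment> \<open>Both quantities are nonnegative and at most their values at the boundary
          point \<open>x = s / t\<close>. There \<open>Phi_boolean\<close> is at most
          \<open>g s / \<alpha>\<close> and the power exceeds it by at most \<open>?E\<close>; this
          adds the third \<open>g s / \<alpha>\<close>.\<close>
        have "F (t * x) \<le> F s" using 3 F(1) by (auto intro: monoD)
        note P = bmaxconv_power_mono[OF F(2,3) neg n1 this]
        have "x \<le> s / t" using 3 t by (simp add: field_simps)
        then have Phi: "Phi_boolean \<alpha> x \<le> Phi_boolean \<alpha> (s / t)" "0 \<le> Phi_boolean \<alpha> x"
          using Phi_boolean_mono[OF \<open>\<alpha> > 0\<close> 3(1)] by (auto simp: Phi_boolean_def)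
        have "Phi_boolean \<alpha> (s / t) \<le> g s / \<alpha>"
          using Phi_boolean_rho_generator_le[of g s \<alpha>, OF gs(1-3)] hs by simp
        moreover have "\<bar>?P s - Phi_boolean \<alpha> (s / t)\<bar> \<le> ?E"
          using near[of "s / t"] t by simp
        ultimately show ?thesis using P Phi g\<alpha> by linarith
      qed
    qed
    also have "\<dots> \<le> C * Max {g s, 1 / real n, inverse (A n) - 1}" (is "_ \<le> C * ?M")
    proof -
      have "1 / real n \<le> ?M" "g s / \<alpha> \<le> ?M / \<alpha>"
        using \<open>\<alpha> > 0\<close> by (auto intro!: divide_right_mono)
      moreover have "C * ?M = ?M + 3 * (?M / \<alpha>)"
        by (simp add: C_def distrib_right)
      ultimately show ?thesis by linarith
    qed
    finally show "\<bar>bmaxconv_power F n (a n * x) - Phi_boolean \<alpha> x\<bar>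
        \<le> C * Max {g (\<rho> (a n)), 1 / real n, inverse (A n) - 1}"
      by (simp add: t_def s_def)
  qed auto
  moreover have "C > 0" using \<open>\<alpha> > 0\<close> by (simp add: C_def add_pos_pos)
  ultimately show ?thesis by blast
qed

end
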